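(* Let $\alpha,\beta\in(0,1)$, let $n\ge1$ be an integer (with $n\le N$ when $J=\{1,\dots,N\}$), and let $\sigma_{(1)}\le\dots\le\sigma_{(n)}$ be the values $\sigma_1,\dots,\sigma_n$ arranged in non-decreasing order. For $1\le k\le n$ let $$\mathcal{S}_{k,n}=\{\theta\in l_2(J):\ \theta_j=0\ \text{for all } j>n,\ \mathrm{Card}\{j\le n:\theta_j\ne0\}\le k\}.$$ For $u\in(0,1)$, let $t_{n,1-u}(\sigma)$ be the $1-u$ quantile of $\sum_{j=1}^n\sigma_j^2\epsilon_j^2$, let $q_{n,1-u}$ be the $1-u$ quantile of $\max_{1\le j\le n}\epsilon_j^2$, and set $$\Phi_u^{(1)}=\mathbf{1}_{\{\sum_{j=1}^nY_j^2>t_{n,1-u}(\sigma)\}},\qquad \Phi_u^{(2)}=\mathbf{1}_{\{\max_{1\le j\le n}Y_j^2/\sigma_j^2>q_{n,1-u}\}},\qquad \Phi_\alpha=\max(\Phi_{\alpha/2}^{(1)},\Phi_{\alpha/2}^{(2)}).$$ Then there exists a constant $C(\alpha,\beta)$ such that for all $k\in\{1,\dots,n\}$ and all $\theta\in\mathcal{S}_{k,n}$ with $$\|\theta\|_\infty\ge C(\alpha,\beta)\Bigl(\sigma_{(n)}\sqrt{\ln(n)}\wedge\Bigl(\sum_{j=1}^n\sigma_j^4\Bigr)^{1/4}\Bigr),$$ one has $\mathbb{P}_\theta(\Phi_\alpha=1)>1-\beta$. This implies that for all $k\in\{1,\dots,n\}$, $$\rho_\infty(\mathcal{S}_{k,n},\alpha,\beta)\le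 C(\alpha,\beta)\Bigl(\sigma_{(n)}\sqrt{\ln(n)}\wedge\Bigl(\sum_{j=1}^n\sigma_j^4\Bigr)^{1/4}\Bigr).$$
   Context: Model: $J=\{1,\dots,N\}$ for some integer $N\ge1$, or $J=\{1,2,3,\dots\}$. One observes $Y=(Y_j)_{j\in J}$ with $Y_j=\theta_j+\sigma_j\epsilon_j$, where $\theta=(\theta_j)_{j\in J}$ is unknown, $\sigma_j>0$ are known, and $(\epsilon_j)_{j\in J}$ are i.i.d. standard normal. $\mathbb{P}_\theta$ is the distribution of $Y$. $\|\theta\|_\infty=\sup_{j\in J}|\theta_j|$, and $x\wedge y=\min(x,y)$. A test is a measurable function $\Phi$ of $Y$ with values in $\{0,1\}$; the null hypothesis "$\theta=0$" is rejected iff $\Phi=1$. It has level $\alpha$ if $\mathbb{P}_0(\Phi=1)\le\alpha$. For $\mathcal{F}\subset l_\infty(J)$ and a level-$\alpha$ test $\Phi_\alpha$, $\rho_\infty(\Phi_\alpha,\mathcal{F},\beta)=\inf\{\rho>0:\ \inf_{\theta\in\mathcal{F},\|\theta\|_\infty\ge\rho}\mathbb{P}_\theta(\Phi_\alpha=1)>1-\beta\}$, and the $(\alpha,\beta)$ minimax rate of testing with respect to the $l_\infty$ norm, $\rho_\infty(\mathcal{F},\alpha,\beta)$, is the infimum of $\rho_\infty(\Phi_\alpha,\mathcal{F},\beta)$ over all level-$\alpha$ tests $\Phi_\alpha$.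
   Formalization: The formal theorem assumes n ≥ 2 instead of n ≥ 1: for n = 1, ln(n) = 0 makes the threshold 0, so θ = 0 qualifies, yet P_0(Φ_α = 1) = α/2, which is not > 1 − β for e.g. α = β = 0.05. *)

theory Defs
  imports "HOL-Probability.Probability"
begin

definition index_set :: "nat set \<Rightarrow> bool" where
  "index_set J \<longleftrightarrow> (\<exists>N\<ge>1. J = {1..N}) \<or> J = {1..}"

text \<open>Real sequences indexed by \<open>J\<close> are elements of \<open>J \<rightarrow>\<^sub>E UNIV\<close>, the
  space underlying the product sigma-algebra.\<close>

abbreviation obs_space :: "nat set \<Rightarrow> (nat \<Rightarrow> real) measure" where
  "obs_space J \<equiv> \<Pi>\<^sub>M j\<in>J. (borel :: real measure)"

text \<open>Joint law of the i.i.d. standard normal errors; only this law enters the law of the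
  observation, so the errors are taken to be the coordinates of this product space.\<close>

definition noise :: "nat set \<Rightarrow> (nat \<Rightarrow> real) measure" where
  "noise J = (\<Pi>\<^sub>M j\<in>J. density lborel std_normal_density)"

definition obs_law :: "nat set \<Rightarrow> (nat \<Rightarrow> real) \<Rightarrow> (nat \<Rightarrow> real) \<Rightarrow> (nat \<Rightarrow> real) measure" where
  "obs_law J \<sigma> \<theta> = distr (noise J) (obs_space J) (\<lambda>\<epsilon>. \<lambda>j\<in>J. \<theta> j + \<sigma> j * \<epsilon> j)"

definition linf_norm :: "nat set \<Rightarrow> (nat \<Rightarrow> real) \<Rightarrow> real" where
  "linf_norm J \<theta> = (SUP j\<in>J. \<bar>\<theta> j\<bar>)"

definition l2_seqs :: "nat set \<Rightarrow> (nat \<Rightarrow> real) set" where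
  "l2_seqs J = {\<theta> \<in> J \<rightarrow>\<^sub>E UNIV. (\<lambda>j. (\<theta> j)\<^sup>2) summable_on J}"

definition is_test :: "nat set \<Rightarrow> ((nat \<Rightarrow> real) \<Rightarrow> nat) \<Rightarrow> bool" where
  "is_test J \<Phi> \<longleftrightarrow> \<Phi> \<in> obs_space J \<rightarrow>\<^sub>M count_space {0, 1}"

definition reject_prob ::
    "nat set \<Rightarrow> (nat \<Rightarrow> real) \<Rightarrow> (nat \<Rightarrow> real) \<Rightarrow> ((nat \<Rightarrow> real) \<Rightarrow> nat) \<Rightarrow> real" where
  "reject_prob J \<sigma> \<theta> \<Phi> =
     measure (obs_law J \<sigma> \<theta>) {y \<in> space (obs_law J \<sigma> \<theta>). \<Phi> y = 1}"

definition level_test ::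
    "nat set \<Rightarrow> (nat \<Rightarrow> real) \<Rightarrow> real \<Rightarrow> ((nat \<Rightarrow> real) \<Rightarrow> nat) \<Rightarrow> bool" where
  "level_test J \<sigma> \<alpha> \<Phi> \<longleftrightarrow> is_test J \<Phi> \<and> reject_prob J \<sigma> (\<lambda>j\<in>J. 0) \<Phi> \<le> \<alpha>"

text \<open>Infima are taken in \<open>ereal\<close>, so that the infimum of an empty set is \<open>\<infinity>\<close>
  (for real \<open>Inf\<close> it would be an unspecified value).\<close>

definition test_rate_inf ::
    "nat set \<Rightarrow> (nat \<Rightarrow> real) \<Rightarrow> ((nat \<Rightarrow> real) \<Rightarrow> nat) \<Rightarrow> (nat \<Rightarrow> real) set \<Rightarrow> real \<Rightarrow> ereal" where
  "test_rate_inf J \<sigma> \<Phi> F \<beta> =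
     Inf (ereal ` {\<rho>. \<rho> > 0 \<and>
       (INF \<theta>\<in>{\<theta>\<in>F. linf_norm J \<theta> \<ge> \<rho>}. ereal (reject_prob J \<sigma> \<theta> \<Phi>)) > ereal (1 - \<beta>)})"

definition minimax_rate_inf ::
    "nat set \<Rightarrow> (nat \<Rightarrow> real) \<Rightarrow> (nat \<Rightarrow> real) set \<Rightarrow> real \<Rightarrow> real \<Rightarrow> ereal" where
  "minimax_rate_inf J \<sigma> F \<alpha> \<beta> =
     (INF \<Phi>\<in>{\<Phi>. level_test J \<sigma> \<alpha> \<Phi>}. test_rate_inf J \<sigma> \<Phi> F \<beta>)"

definition sparse_set :: "nat set \<Rightarrow> nat \<Rightarrow> nat \<Rightarrow> (nat \<Rightarrow> real) set" where
  "sparse_set J k n =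
     {\<theta> \<in> l2_seqs J. (\<forall>j\<in>J. j > n \<longrightarrow> \<theta> j = 0) \<and> card {j\<in>{1..n}. \<theta> j \<noteq> 0} \<le> k}"

definition order_stat :: "(nat \<Rightarrow> real) \<Rightarrow> nat \<Rightarrow> nat \<Rightarrow> real" where
  "order_stat \<sigma> n i = sort (map \<sigma> [1..<Suc n]) ! (i - 1)"

definition quantile :: "real measure \<Rightarrow> real \<Rightarrow> real" where
  "quantile \<mu> p = Inf {x. cdf \<mu> x \<ge> p}"

definition sum_sq_quantile :: "nat set \<Rightarrow> (nat \<Rightarrow> real) \<Rightarrow> nat \<Rightarrow> real \<Rightarrow> real" where
  "sum_sq_quantile J \<sigma> n p =
     quantile (distr (noise J) borel (\<lambda>\<epsilon>. \<Sum>j=1..n. (\<sigma> j)\<^sup>2 * (\<epsilon> j)\<^sup>2)) p"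

definition max_sq_quantile :: "nat set \<Rightarrow> nat \<Rightarrow> real \<Rightarrow> real" where
  "max_sq_quantile J n p =
     quantile (distr (noise J) borel (\<lambda>\<epsilon>. MAX j\<in>{1..n}. (\<epsilon> j)\<^sup>2)) p"

definition sum_test :: "nat set \<Rightarrow> (nat \<Rightarrow> real) \<Rightarrow> nat \<Rightarrow> real \<Rightarrow> (nat \<Rightarrow> real) \<Rightarrow> nat" where
  "sum_test J \<sigma> n u y = of_bool ((\<Sum>j=1..n. (y j)\<^sup>2) > sum_sq_quantile J \<sigma> n (1 - u))"

definition max_test :: "nat set \<Rightarrow> (nat \<Rightarrow> real) \<Rightarrow> nat \<Rightarrow> real \<Rightarrow> (nat \<Rightarrow> real) \<Rightarrow> nat" where
  "max_test J \<sigma> n u y =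
     of_bool ((MAX j\<in>{1..n}. (y j)\<^sup>2 / (\<sigma> j)\<^sup>2) > max_sq_quantile J n (1 - u))"

definition combined_test :: "nat set \<Rightarrow> (nat \<Rightarrow> real) \<Rightarrow> nat \<Rightarrow> real \<Rightarrow> (nat \<Rightarrow> real) \<Rightarrow> nat" where
  "combined_test J \<sigma> n \<alpha> y = max (sum_test J \<sigma> n (\<alpha> / 2) y) (max_test J \<sigma> n (\<alpha> / 2) y)"

end

theory Submission
  imports Defs
begin

text \<open>
  A sequence \<open>\<theta>\<close> supported on \<open>{1..n}\<close> attains its sup-norm at some coordinate \<open>j\<close>, and one large
  coordinate is all that either test needs. Whichever of the two terms of the minimum is the smaller one, the corresponding test detects
  \<open>\<theta>\<close>.

  The max test: the maximum of \<open>n\<close> squared standard Gaussians has an exponential tail, so its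
  critical value is at most \<open>A ln n\<close>, with \<open>A\<close> depending on \<open>\<alpha>\<close> only. If \<open>\<bar>\<theta> j\<bar>\<close> is a large multiple of
  \<open>\<sigma> j sqrt (ln n)\<close>, then \<open>Y j / \<sigma> j\<close> alone exceeds the critical value unless the noise at the single
  coordinate \<open>j\<close> is large, which has small probability by Chebyshev (\<open>max_sq_quantile_le\<close>,
  \<open>max_test_power\<close>).

  The sum test: with \<open>V = \<Sum> \<sigma>\<^sup>4\<close> and \<open>T = \<Sum> \<theta>\<^sup>2\<close>, the statistic \<open>\<Sum> Y\<^sup>2\<close> has mean \<open>T + \<Sum> \<sigma>\<^sup>2\<close> and
  variance \<open>4 \<Sum> \<theta>\<^sup>2 \<sigma>\<^sup>2 + 2 V\<close>. Since \<open>\<sigma>\<^sup>2 \<le> sqrt V\<close> coordinatewise, the variance is of order at most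
  \<open>T sqrt V + V\<close>. Chebyshev under \<open>\<theta> = 0\<close> places the critical value within a multiple of
  \<open>sqrt V\<close> of \<open>\<Sum> \<sigma>\<^sup>2\<close>, and Chebyshev under \<open>\<theta>\<close> shows that the statistic passes it as soon as \<open>T\<close> is
  a large multiple of \<open>sqrt V\<close>; and \<open>T \<ge> (\<theta> j)\<^sup>2\<close> (\<open>sum_sq_quantile_le\<close>, \<open>sum_test_power\<close>).

  Both uses of Chebyshev, and the one for the single coordinate, are instances of one bound for
  \<open>\<Sum> (a \<epsilon> + b (\<epsilon>\<^sup>2 - 1))\<close> (\<open>noise_quadratic_tail\<close>). The level of the combined test is at most the sum
  of the levels of its two parts. The statement on the separation rate needs power bounded away from
  \<open>1 - \<beta>\<close> uniformly in \<open>\<theta>\<close>, as an infimum of strict inequalities need not be strict; therefore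
  the constant is chosen for power at least \<open>1 - \<beta> / 2\<close>.
\<close>

section \<open>Quantiles\<close>

text \<open>Right continuity of the distribution function makes the infimum defining the quantile
  attained, so a test that rejects strictly above its quantile has the nominal level even if
  the distribution has atoms.\<close>

lemma (in real_distribution) prob_above_quantile_le:
  assumes "0 < u" "u < 1"
  shows "measure M {quantile M (1 - u)<..} \<le> u"
proof -
  let ?S = "{x. 1 - u \<le> cdf M x}"
  let ?q = "quantile M (1 - u)"
  have "eventually (\<lambda>x. cdf M x > 1 - u) at_top"
    using order_tendstoD(1)[OF cdf_lim_at_top_prob, of "1 - u"] assms by simp
  then obtain x0 where "cdf M x0 > 1 - u"
    by (auto simp: eventually_at_top_linorder)
  then have ne: "?S \<noteq> {}" by (auto intro: less_imp_le)
  have above: "1 - u \<le> cdf M x" if "?q < x" for x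
  proof -
    have "Inf ?S < x" using that by (simp add: quantile_def)
    from cInf_lessD[OF ne this] obtain z where "z \<in> ?S" "z < x" by blast
    then show ?thesis using cdf_nondecreasing[of z x] by auto
  qed
  have "1 - u \<le> cdf M ?q"
  proof (rule tendsto_lowerbound)
    show "(cdf M \<longlongrightarrow> cdf M ?q) (at_right ?q)"
      using cdf_is_right_cont[of ?q] by (simp add: continuous_within)
    show "\<forall>\<^sub>F x in at_right ?q. 1 - u \<le> cdf M x"
      using above by (auto simp: eventually_at_right_field intro!: exI[of _ "?q + 1"])
  qed auto
  moreover have "measure M {?q<..} = 1 - measure M {..?q}"
  proof -
    have "{?q<..} = space M - {..?q}" by auto
    then show ?thesis by (simp only:) (rule prob_compl, simp)
  qed
  ultimately show ?thesis by (simp add: cdf_def2)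
qed

lemma (in real_distribution) quantile_le:
  assumes "u < 1" and tail: "measure M {x<..} \<le> u"
  shows "quantile M (1 - u) \<le> x"
  unfolding quantile_def
proof (rule cInf_lower)
  have "{x<..} = space M - {..x}" by auto
  then have "measure M {x<..} = 1 - measure M {..x}"
    by (simp only:) (rule prob_compl, simp)
  then show "x \<in> {x. 1 - u \<le> cdf M x}" using tail by (simp add: cdf_def2)
  have "eventually (\<lambda>x. cdf M x < 1 - u) at_bot"
    using order_tendstoD(2)[OF cdf_lim_at_bot, of "1 - u"] assms by simp
  then obtain b where b: "\<And>y. y \<le> b \<Longrightarrow> cdf M y < 1 - u"
    by (auto simp: eventually_at_bot_linorder)
  show "bdd_below {x. 1 - u \<le> cdf M x}"
  proof (rule bdd_belowI[of _ b])
    show "b \<le> y" if "y \<in> {x. 1 - u \<le> cdf M x}" for y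
      using b[of y] that by fastforce
  qed
qed

lemma (in prob_space) prob_above_quantile_distr_le:
  assumes [measurable]: "X \<in> borel_measurable M" and "0 < u" "u < 1"
  shows "prob {\<omega> \<in> space M. X \<omega> > quantile (distr M borel X) (1 - u)} \<le> u"
proof -
  interpret D: real_distribution "distr M borel X" by (rule real_distribution_distr) simp
  have "prob {\<omega> \<in> space M. X \<omega> > quantile (distr M borel X) (1 - u)}
      = measure (distr M borel X) {quantile (distr M borel X) (1 - u)<..}"
    by (subst measure_distr) (auto intro!: arg_cong[where f = prob])
  then show ?thesis using D.prob_above_quantile_le[OF assms(2,3)] by simp
qed

lemma (in prob_space) quantile_distr_le:
  assumes [measurable]: "X \<in> borel_measurable M" and "u < 1"
    and tail: "prob {\<omega> \<in> space M. X \<omega> > x} \<le> u"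
  shows "quantile (distr M borel X) (1 - u) \<le> x"
proof -
  interpret D: real_distribution "distr M borel X" by (rule real_distribution_distr) simp
  have "prob {\<omega> \<in> space M. X \<omega> > x} = measure (distr M borel X) {x<..}"
    by (subst measure_distr) (auto intro!: arg_cong[where f = prob])
  then show ?thesis using D.quantile_le[OF assms(2)] tail by simp
qed

section \<open>Moments of independent sums\<close>

text \<open>Adding one variable at a time, the cross term \<open>X i * (\<Sum>j\<in>I. X j)\<close> is a product of independent
  centred variables and so has mean zero; integrability of the square of the sum comes along in
  the same induction.\<close>

lemma (in prob_space) second_moment_sum_indep:
  fixes X :: "'i \<Rightarrow> 'a \<Rightarrow> real"
  assumes "finite I" "indep_vars (\<lambda>_. borel) X I"
    and "\<And>i. i \<in> I \<Longrightarrow> integrable M (\<lambda>\<omega>. (X i \<omega>)\<^sup>2)"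
    and "\<And>i. i \<in> I \<Longrightarrow> expectation (X i) = 0"
  shows "integrable M (\<lambda>\<omega>. (\<Sum>i\<in>I. X i \<omega>)\<^sup>2) \<and>
    expectation (\<lambda>\<omega>. (\<Sum>i\<in>I. X i \<omega>)\<^sup>2) = (\<Sum>i\<in>I. expectation (\<lambda>\<omega>. (X i \<omega>)\<^sup>2))"
  using assms
proof (induction I rule: finite_induct)
  case empty
  then show ?case by simp
next
  case (insert i I)
  let ?S = "\<lambda>\<omega>. \<Sum>i\<in>I. X i \<omega>"
  have rv: "random_variable borel (X j)" if "j \<in> insert i I" for j
    using insert.prems(1) that by (auto simp: indep_vars_def)
  have IH: "integrable M (\<lambda>\<omega>. (?S \<omega>)\<^sup>2)"
    "expectation (\<lambda>\<omega>. (?S \<omega>)\<^sup>2) = (\<Sum>i\<in>I. expectation (\<lambda>\<omega>. (X i \<omega>)\<^sup>2))"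
    using insert.IH insert.prems indep_vars_subset[OF insert.prems(1), of I] by auto
  have intX: "integrable M (X j)" if "j \<in> insert i I" for j
    using square_integrable_imp_integrable[OF rv[OF that] insert.prems(2)[OF that]] .
  have intS: "integrable M ?S" using intX by auto
  have ES: "expectation ?S = 0"
    using intX insert.prems(3) by (subst Bochner_Integration.integral_sum) auto
  have ind: "indep_var borel (X i) borel ?S"
    using insert.hyps insert.prems(1) by (intro indep_vars_sum) auto
  have cross: "integrable M (\<lambda>\<omega>. X i \<omega> * ?S \<omega>)" "expectation (\<lambda>\<omega>. X i \<omega> * ?S \<omega>) = 0"
    using indep_var_integrable[OF ind intX intS] indep_var_lebesgue_integral[OF ind intX intS] ES
    by auto
  have eq: "(\<lambda>\<omega>. (\<Sum>j\<in>insert i I. X j \<omega>)\<^sup>2)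
      = (\<lambda>\<omega>. (X i \<omega>)\<^sup>2 + 2 * (X i \<omega> * ?S \<omega>) + (?S \<omega>)\<^sup>2)"
    using insert.hyps by (auto simp: power2_eq_square algebra_simps)
  have "integrable M (\<lambda>\<omega>. (X i \<omega>)\<^sup>2)" using insert.prems(2) by auto
  then show ?case unfolding eq using IH cross insert.hyps by simp
qed

section \<open>Gaussian noise\<close>

abbreviation std_gauss :: "real measure" where
  "std_gauss \<equiv> density lborel std_normal_density"

lemma prob_space_std_gauss: "prob_space std_gauss"
  by (rule prob_space_normal_density) simp

lemma std_gauss_even_moment:
  "integrable std_gauss (\<lambda>x. x ^ (2 * k))"
  "(\<integral>x. x ^ (2 * k) \<partial>std_gauss) = fact (2 * k) / (2 ^ k * fact k)"
  using std_normal_moment_even[of k]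
  by (auto simp: has_bochner_integral_iff integrable_density integral_density)

lemma std_gauss_odd_moment:
  "integrable std_gauss (\<lambda>x. x ^ (2 * k + 1))"
  "(\<integral>x. x ^ (2 * k + 1) \<partial>std_gauss) = 0"
  using std_normal_moment_odd[of k]
  by (auto simp: has_bochner_integral_iff integrable_density integral_density)

text \<open>The variables \<open>x\<close> and \<open>x\<^sup>2 - 1\<close> are the first two Hermite polynomials: centred, orthogonal, with
  variances 1 and 2. Hence no mixed term \<open>a * b\<close> in the variance.\<close>

lemma std_gauss_quadratic:
  fixes a b :: real
  shows "integrable std_gauss (\<lambda>x. a * x + b * (x\<^sup>2 - 1))"
    and "(\<integral>x. a * x + b * (x\<^sup>2 - 1) \<partial>std_gauss) = 0"
    and "integrable std_gauss (\<lambda>x. (a * x + b * (x\<^sup>2 - 1))\<^sup>2)"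
    and "(\<integral>x. (a * x + b * (x\<^sup>2 - 1))\<^sup>2 \<partial>std_gauss) = a\<^sup>2 + 2 * b\<^sup>2"
proof -
  interpret prob_space std_gauss by (rule prob_space_std_gauss)
  have i: "integrable std_gauss (\<lambda>x. x)" "integrable std_gauss (\<lambda>x. x ^ 2)"
    "integrable std_gauss (\<lambda>x. x ^ 3)" "integrable std_gauss (\<lambda>x. x ^ 4)"
    using std_gauss_even_moment(1)[of 1] std_gauss_even_moment(1)[of 2]
      std_gauss_odd_moment(1)[of 0] std_gauss_odd_moment(1)[of 1] by simp_all
  have e: "(\<integral>x. x \<partial>std_gauss) = 0" "(\<integral>x. x ^ 2 \<partial>std_gauss) = 1"
    "(\<integral>x. x ^ 3 \<partial>std_gauss) = 0" "(\<integral>x. x ^ 4 \<partial>std_gauss) = 3"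
    using std_gauss_even_moment(2)[of 1] std_gauss_even_moment(2)[of 2]
      std_gauss_odd_moment(2)[of 0] std_gauss_odd_moment(2)[of 1]
    by (simp_all add: fact_numeral)
  show "integrable std_gauss (\<lambda>x. a * x + b * (x\<^sup>2 - 1))"
    using i by auto
  show "(\<integral>x. a * x + b * (x\<^sup>2 - 1) \<partial>std_gauss) = 0"
    using i e prob_space by simp
  have eq: "(\<lambda>x. (a * x + b * (x\<^sup>2 - 1))\<^sup>2)
      = (\<lambda>x. b\<^sup>2 + (- 2 * a * b) * x + (a\<^sup>2 - 2 * b\<^sup>2) * x ^ 2 + (2 * a * b) * x ^ 3 + b\<^sup>2 * x ^ 4)"
    by (rule ext) algebra
  show "integrable std_gauss (\<lambda>x. (a * x + b * (x\<^sup>2 - 1))\<^sup>2)"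
    unfolding eq using i by auto
  show "(\<integral>x. (a * x + b * (x\<^sup>2 - 1))\<^sup>2 \<partial>std_gauss) = a\<^sup>2 + 2 * b\<^sup>2"
    unfolding eq using i e prob_space by simp
qed

text \<open>The exponent \<open>1/4\<close> is a convenient value below the critical \<open>1/2\<close>: multiplying the density by
  \<open>exp (x\<^sup>2 / 4)\<close> gives \<open>sqrt 2\<close> times the Gaussian density of variance 2.\<close>

lemma std_gauss_exp_square:
  "integrable std_gauss (\<lambda>x. exp (x\<^sup>2 / 4))"
  "(\<integral>x. exp (x\<^sup>2 / 4) \<partial>std_gauss) = sqrt 2"
proof -
  have eq: "std_normal_density x * exp (x\<^sup>2 / 4) = sqrt 2 * normal_density 0 (sqrt 2) x" for x
  proof -
    have "exp (- x\<^sup>2 / 2) * exp (x\<^sup>2 / 4) = exp (- x\<^sup>2 / 4)"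
      by (simp add: exp_add[symmetric])
    moreover have "sqrt (2 * pi * 2) = sqrt 2 * sqrt (2 * pi)"
      by (simp add: real_sqrt_mult)
    ultimately show ?thesis by (simp add: normal_density_def)
  qed
  show "integrable std_gauss (\<lambda>x. exp (x\<^sup>2 / 4))"
    by (subst integrable_density) (auto simp: eq)
  show "(\<integral>x. exp (x\<^sup>2 / 4) \<partial>std_gauss) = sqrt 2"
    by (subst integral_density) (auto simp: eq)
qed

lemma prob_space_noise: "prob_space (noise J)"
  unfolding noise_def by (rule prob_space_PiM) (rule prob_space_std_gauss)

lemma sets_noise [measurable_cong]: "sets (noise J) = sets (obs_space J)"
  unfolding noise_def by (rule sets_PiM_cong) auto

lemma comp_measurable_noise:
  assumes "K \<subseteq> J" "j \<in> K"
  shows "(\<lambda>\<epsilon>. \<epsilon> j) \<in> borel_measurable (noise J)"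
  using assms by (auto intro!: measurable_component_singleton
      simp: measurable_cong_sets[OF sets_noise refl])

lemma distr_noise_component:
  assumes "j \<in> J"
  shows "distr (noise J) borel (\<lambda>\<epsilon>. \<epsilon> j) = std_gauss"
proof -
  have "distr (noise J) borel (\<lambda>\<epsilon>. \<epsilon> j) = distr (noise J) std_gauss (\<lambda>\<epsilon>. \<epsilon> j)"
    by (rule distr_cong) auto
  also have "\<dots> = std_gauss"
    unfolding noise_def by (rule distr_PiM_component[OF prob_space_std_gauss assms])
  finally show ?thesis .
qed

lemma noise_component_integral:
  fixes f :: "real \<Rightarrow> real"
  assumes "j \<in> J" and [measurable]: "f \<in> borel_measurable borel"
  shows "integrable (noise J) (\<lambda>\<epsilon>. f (\<epsilon> j)) \<longleftrightarrow> integrable std_gauss f"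
    and "(\<integral>\<epsilon>. f (\<epsilon> j) \<partial>noise J) = (\<integral>x. f x \<partial>std_gauss)"
proof -
  have [measurable]: "(\<lambda>\<epsilon>. \<epsilon> j) \<in> borel_measurable (noise J)" using assms(1) by measurable
  show "integrable (noise J) (\<lambda>\<epsilon>. f (\<epsilon> j)) \<longleftrightarrow> integrable std_gauss f"
    unfolding distr_noise_component[OF assms(1), symmetric]
    by (subst integrable_distr_eq) auto
  show "(\<integral>\<epsilon>. f (\<epsilon> j) \<partial>noise J) = (\<integral>x. f x \<partial>std_gauss)"
    unfolding distr_noise_component[OF assms(1), symmetric]
    by (subst integral_distr) auto
qed

lemma indep_vars_noise_components:
  assumes "K \<subseteq> J"
  shows "prob_space.indep_vars (noise J) (\<lambda>_. borel) (\<lambda>j \<epsilon>. \<epsilon> j) K"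
proof (cases "J = {}")
  case True
  interpret prob_space "noise J" by (rule prob_space_noise)
  have "indep_vars (\<lambda>_. borel) (\<lambda>j \<epsilon>. \<epsilon> j) {}" by (simp add: indep_vars_def indep_sets_def)
  then show ?thesis using True assms by auto
next
  case False
  interpret prob_space "noise J" by (rule prob_space_noise)
  have "indep_vars (\<lambda>_. borel) (\<lambda>j \<epsilon>. \<epsilon> j) J"
  proof (subst indep_vars_iff_distr_eq_PiM'[OF False])
    show "random_variable borel (\<lambda>\<epsilon>. \<epsilon> i)" if "i \<in> J" for i
      using that by measurable
    have "distr (noise J) (obs_space J) (\<lambda>x. \<lambda>i\<in>J. x i) = distr (noise J) (noise J) (\<lambda>x. x)"
      by (rule distr_cong) (auto simp: sets_noise sets_eq_imp_space_eq[OF sets_noise] space_PiM PiE_def extensional_restrict)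
    also have "\<dots> = (\<Pi>\<^sub>M i\<in>J. distr (noise J) borel (\<lambda>\<epsilon>. \<epsilon> i))"
      by (auto simp: distr_id noise_def distr_noise_component[unfolded noise_def] intro!: PiM_cong)
    finally show "distr (noise J) (obs_space J) (\<lambda>x. \<lambda>i\<in>J. x i)
      = (\<Pi>\<^sub>M i\<in>J. distr (noise J) borel (\<lambda>\<epsilon>. \<epsilon> i))" .
  qed
  then show ?thesis using assms by (rule indep_vars_subset)
qed

text \<open>The centred statistic of the sum test has this form with \<open>b = \<sigma>\<^sup>2\<close>, where \<open>a = 0\<close> under the null
  hypothesis and \<open>a = 2 \<theta> \<sigma>\<close> under \<open>\<theta>\<close>; a single noise coordinate is the case \<open>a = 1\<close>, \<open>b = 0\<close>.\<close>

lemma noise_quadratic_tail: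
  fixes a b :: "nat \<Rightarrow> real"
  assumes K: "finite K" "K \<subseteq> J" and "t > 0"
  shows "measure (noise J) {\<epsilon> \<in> space (noise J).
      \<bar>\<Sum>j\<in>K. a j * \<epsilon> j + b j * ((\<epsilon> j)\<^sup>2 - 1)\<bar> \<ge> t} \<le> (\<Sum>j\<in>K. (a j)\<^sup>2 + 2 * (b j)\<^sup>2) / t\<^sup>2"
proof -
  interpret prob_space "noise J" by (rule prob_space_noise)
  let ?X = "\<lambda>j (\<epsilon> :: nat \<Rightarrow> real). a j * \<epsilon> j + b j * ((\<epsilon> j)\<^sup>2 - 1)"
  let ?S = "\<lambda>\<epsilon>. \<Sum>j\<in>K. ?X j \<epsilon>"
  note [measurable] = comp_measurable_noise[OF K(2)]
  have ind: "indep_vars (\<lambda>_. borel) ?X K"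
    using indep_vars_compose2[OF indep_vars_noise_components[OF K(2)],
        of "\<lambda>j x. a j * x + b j * (x\<^sup>2 - 1)" "\<lambda>_. borel"] by simp
  have int: "integrable (noise J) (\<lambda>\<epsilon>. (?X j \<epsilon>)\<^sup>2)" "expectation (?X j) = 0"
    "expectation (\<lambda>\<epsilon>. (?X j \<epsilon>)\<^sup>2) = (a j)\<^sup>2 + 2 * (b j)\<^sup>2" "integrable (noise J) (?X j)"
    if "j \<in> K" for j
  proof -
    have j: "j \<in> J" using that K(2) by auto
    note f = noise_component_integral[OF j, of "\<lambda>x. a j * x + b j * (x\<^sup>2 - 1)"]
    note g = noise_component_integral[OF j, of "\<lambda>x. (a j * x + b j * (x\<^sup>2 - 1))\<^sup>2"]
    show "integrable (noise J) (\<lambda>\<epsilon>. (?X j \<epsilon>)\<^sup>2)" using g(1) std_gauss_quadratic by simp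
    show "expectation (?X j) = 0" using f(2) std_gauss_quadratic by simp
    show "expectation (\<lambda>\<epsilon>. (?X j \<epsilon>)\<^sup>2) = (a j)\<^sup>2 + 2 * (b j)\<^sup>2"
      using g(2) std_gauss_quadratic by simp
    show "integrable (noise J) (?X j)" using f(1) std_gauss_quadratic by simp
  qed
  note S2 = second_moment_sum_indep[OF K(1) ind int(1,2), simplified]
  have ES: "expectation ?S = 0" using int by (subst Bochner_Integration.integral_sum) auto
  have "prob {\<epsilon> \<in> space (noise J). \<bar>?S \<epsilon> - expectation ?S\<bar> \<ge> t} \<le> variance ?S / t\<^sup>2"
    using S2 \<open>t > 0\<close> by (intro Chebyshev_inequality) auto
  then show ?thesis unfolding ES using S2 int(3) by simp
qed

text \<open>Union bound and Markov's inequality for \<open>exp (\<epsilon>\<^sup>2 / 4)\<close>. Chebyshev would lose here: a fixed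
  polynomial moment bounds the critical value by a power of \<open>n\<close> instead of \<open>ln n\<close>.\<close>

lemma noise_max_tail:
  assumes K: "finite K" "K \<noteq> {}" "K \<subseteq> J"
  shows "measure (noise J) {\<epsilon> \<in> space (noise J). (MAX j\<in>K. (\<epsilon> j)\<^sup>2) > x}
    \<le> card K * (sqrt 2 * exp (- x / 4))"
proof -
  interpret prob_space "noise J" by (rule prob_space_noise)
  let ?A = "\<lambda>j. {\<epsilon> \<in> space (noise J). exp ((\<epsilon> j)\<^sup>2 / 4) \<ge> exp (x / 4)}"
  note [measurable] = comp_measurable_noise[OF K(3)]
  have A: "?A j \<in> events" if "j \<in> K" for j using that by measurable
  have pA: "prob (?A j) \<le> sqrt 2 * exp (- x / 4)" if "j \<in> K" for j
  proof -
    have j: "j \<in> J" using that K(3) by auto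
    note f = noise_component_integral[OF j, of "\<lambda>x. exp (x\<^sup>2 / 4)"]
    have "prob (?A j) \<le> expectation (\<lambda>\<epsilon>. exp ((\<epsilon> j)\<^sup>2 / 4)) / exp (x / 4)"
      using f(1) std_gauss_exp_square(1)
      by (intro integral_Markov_inequality_measure[where A = "{}"]) auto
    also have "\<dots> = sqrt 2 * exp (- x / 4)"
      using f(2) std_gauss_exp_square(2) by (simp add: exp_minus field_simps)
    finally show ?thesis .
  qed
  have "{\<epsilon> \<in> space (noise J). (MAX j\<in>K. (\<epsilon> j)\<^sup>2) > x} \<subseteq> (\<Union>j\<in>K. ?A j)"
    using K(1,2) by (auto simp: Max_gr_iff)
  then have "prob {\<epsilon> \<in> space (noise J). (MAX j\<in>K. (\<epsilon> j)\<^sup>2) > x} \<le> prob (\<Union>j\<in>K. ?A j)"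
    using A K(1) by (intro finite_measure_mono) auto
  also have "\<dots> \<le> (\<Sum>j\<in>K. prob (?A j))"
    using A K(1) by (intro finite_measure_subadditive_finite) auto
  also have "\<dots> \<le> card K * (sqrt 2 * exp (- x / 4))"
    using sum_bounded_above[of K "\<lambda>j. prob (?A j)"] pA by simp
  finally show ?thesis .
qed

section \<open>The two tests\<close>

lemma combined_test_eq_1_iff:
  "combined_test J \<sigma> n \<alpha> y = 1 \<longleftrightarrow>
    (\<Sum>j=1..n. (y j)\<^sup>2) > sum_sq_quantile J \<sigma> n (1 - \<alpha> / 2) \<or>
    (MAX j\<in>{1..n}. (y j)\<^sup>2 / (\<sigma> j)\<^sup>2) > max_sq_quantile J n (1 - \<alpha> / 2)"
  by (auto simp: combined_test_def sum_test_def max_test_def)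

lemma is_test_combined_test:
  assumes "{1..n} \<subseteq> J"
  shows "is_test J (combined_test J \<sigma> n \<alpha>)"
proof -
  have [measurable]: "(\<lambda>y. y j) \<in> borel_measurable (obs_space J)" if "j \<in> {1..n}" for j
    using that assms by (auto intro!: measurable_component_singleton)
  have eq: "combined_test J \<sigma> n \<alpha> = (\<lambda>y. if
      (\<Sum>j=1..n. (y j)\<^sup>2) > sum_sq_quantile J \<sigma> n (1 - \<alpha> / 2) \<or>
      (MAX j\<in>{1..n}. (y j)\<^sup>2 / (\<sigma> j)\<^sup>2) > max_sq_quantile J n (1 - \<alpha> / 2) then 1 else 0)"
    by (auto simp: combined_test_def sum_test_def max_test_def)
  show ?thesis unfolding is_test_def eq
    by (rule measurable_If) auto
qed

lemma reject_prob_noise: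
  assumes "is_test J \<Phi>"
  shows "reject_prob J \<sigma> \<theta> \<Phi> =
    measure (noise J) {\<epsilon> \<in> space (noise J). \<Phi> (\<lambda>j\<in>J. \<theta> j + \<sigma> j * \<epsilon> j) = 1}"
proof -
  have [measurable]: "\<Phi> \<in> obs_space J \<rightarrow>\<^sub>M count_space {0, 1}"
    using assms by (simp add: is_test_def)
  have shift: "(\<lambda>\<epsilon>. \<lambda>j\<in>J. \<theta> j + \<sigma> j * \<epsilon> j) \<in> noise J \<rightarrow>\<^sub>M obs_space J"
    by measurable
  have "{y \<in> space (obs_space J). \<Phi> y = 1} \<in> sets (obs_space J)"
  proof -
    have "\<Phi> -` {1} \<inter> space (obs_space J) \<in> sets (obs_space J)"
      using measurable_sets[OF assms[unfolded is_test_def], of "{1}"] by simp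
    then show ?thesis by (simp add: vimage_def Int_def conj_commute)
  qed
  then show ?thesis unfolding reject_prob_def obs_law_def
    using measurable_space[OF shift]
    by (subst measure_distr[OF shift]) (auto intro!: arg_cong[where f = "measure (noise J)"])
qed

lemma reject_prob_combined_test:
  assumes "{1..n} \<subseteq> J" "n \<ge> 1"
  shows "reject_prob J \<sigma> \<theta> (combined_test J \<sigma> n \<alpha>) =
    measure (noise J) {\<epsilon> \<in> space (noise J).
      (\<Sum>j=1..n. (\<theta> j + \<sigma> j * \<epsilon> j)\<^sup>2) > sum_sq_quantile J \<sigma> n (1 - \<alpha> / 2) \<or>
      (MAX j\<in>{1..n}. (\<theta> j + \<sigma> j * \<epsilon> j)\<^sup>2 / (\<sigma> j)\<^sup>2) > max_sq_quantile J n (1 - \<alpha> / 2)}"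
proof -
  have "(\<Sum>j=1..n. ((\<lambda>j\<in>J. \<theta> j + \<sigma> j * \<epsilon> j) j)\<^sup>2) = (\<Sum>j=1..n. (\<theta> j + \<sigma> j * \<epsilon> j)\<^sup>2)" for \<epsilon>
    using assms(1) by (intro sum.cong) auto
  moreover have "(\<lambda>j. ((\<lambda>j\<in>J. \<theta> j + \<sigma> j * \<epsilon> j) j)\<^sup>2 / (\<sigma> j)\<^sup>2) ` {1..n}
      = (\<lambda>j. (\<theta> j + \<sigma> j * \<epsilon> j)\<^sup>2 / (\<sigma> j)\<^sup>2) ` {1..n}" for \<epsilon>
    using assms(1) by (intro image_cong) auto
  ultimately show ?thesis
    unfolding reject_prob_noise[OF is_test_combined_test[OF assms(1)]] combined_test_eq_1_iff
    by (simp only:)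
qed

lemma level_combined_test:
  assumes K: "{1..n} \<subseteq> J" "n \<ge> 1" and pos: "\<forall>j\<in>J. \<sigma> j > 0" and "0 < \<alpha>" "\<alpha> < 1"
  shows "level_test J \<sigma> \<alpha> (combined_test J \<sigma> n \<alpha>)"
proof -
  interpret prob_space "noise J" by (rule prob_space_noise)
  note [measurable] = comp_measurable_noise[OF K(1)]
  let ?t = "sum_sq_quantile J \<sigma> n (1 - \<alpha> / 2)" and ?q = "max_sq_quantile J n (1 - \<alpha> / 2)"
  let ?A = "{\<epsilon> \<in> space (noise J). (\<Sum>j=1..n. (\<sigma> j)\<^sup>2 * (\<epsilon> j)\<^sup>2) > ?t}"
  let ?B = "{\<epsilon> \<in> space (noise J). (MAX j\<in>{1..n}. (\<epsilon> j)\<^sup>2) > ?q}"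
  have sum_eq: "(\<Sum>j=1..n. ((\<lambda>j\<in>J. 0) j + \<sigma> j * \<epsilon> j)\<^sup>2) = (\<Sum>j=1..n. (\<sigma> j)\<^sup>2 * (\<epsilon> j)\<^sup>2)" for \<epsilon>
    using K(1) by (intro sum.cong) (auto simp: power_mult_distrib)
  have max_eq: "(\<lambda>j. ((\<lambda>j\<in>J. 0) j + \<sigma> j * \<epsilon> j)\<^sup>2 / (\<sigma> j)\<^sup>2) ` {1..n} = (\<lambda>j. (\<epsilon> j)\<^sup>2) ` {1..n}" for \<epsilon>
  proof (rule image_cong[OF refl])
    fix j assume "j \<in> {1..n}"
    then have "j \<in> J" using K(1) by auto
    moreover have "\<sigma> j \<noteq> 0" using pos \<open>j \<in> J\<close> by fastforce
    ultimately show "((\<lambda>j\<in>J. 0) j + \<sigma> j * \<epsilon> j)\<^sup>2 / (\<sigma> j)\<^sup>2 = (\<epsilon> j)\<^sup>2"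
      by (simp add: power_mult_distrib)
  qed
  have [measurable]: "random_variable borel (\<lambda>\<epsilon>. MAX j\<in>{1..n}. (\<epsilon> j)\<^sup>2)"
    by (rule borel_measurable_Max) auto
  have "reject_prob J \<sigma> (\<lambda>j\<in>J. 0) (combined_test J \<sigma> n \<alpha>) = prob (?A \<union> ?B)"
    unfolding reject_prob_combined_test[OF K] sum_eq max_eq
    by (rule arg_cong[where f = prob]) auto
  also have "\<dots> \<le> prob ?A + prob ?B"
    by (rule measure_Un_le) auto
  also have "\<dots> \<le> \<alpha> / 2 + \<alpha> / 2"
    unfolding sum_sq_quantile_def max_sq_quantile_def using assms(4,5)
    by (intro add_mono prob_above_quantile_distr_le) auto
  finally show ?thesis by (simp add: level_test_def is_test_combined_test[OF K(1)])
qed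

section \<open>Upper bounds for the critical values\<close>

lemma sum_sq_quantile_le:
  assumes K: "{1..n} \<subseteq> J" and u: "0 < u" "u < 1" and V: "(\<Sum>j=1..n. (\<sigma> j) ^ 4) > 0"
  shows "sum_sq_quantile J \<sigma> n (1 - u)
    \<le> (\<Sum>j=1..n. (\<sigma> j)\<^sup>2) + sqrt (2 / u) * sqrt (\<Sum>j=1..n. (\<sigma> j) ^ 4)"
proof -
  interpret prob_space "noise J" by (rule prob_space_noise)
  note [measurable] = comp_measurable_noise[OF K]
  let ?V = "\<Sum>j=1..n. (\<sigma> j) ^ 4" and ?S = "\<Sum>j=1..n. (\<sigma> j)\<^sup>2"
  define s where "s = sqrt (2 / u) * sqrt ?V"
  have s: "s > 0" "s\<^sup>2 = 2 * ?V / u"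
    using u V by (auto simp: s_def power_mult_distrib)
  have eq: "(\<Sum>j=1..n. 0 * \<epsilon> j + (\<sigma> j)\<^sup>2 * ((\<epsilon> j)\<^sup>2 - 1))
      = (\<Sum>j=1..n. (\<sigma> j)\<^sup>2 * (\<epsilon> j)\<^sup>2) - ?S" for \<epsilon> :: "nat \<Rightarrow> real"
    by (simp add: sum_subtractf[symmetric] right_diff_distrib)
  have "prob {\<epsilon> \<in> space (noise J). (\<Sum>j=1..n. (\<sigma> j)\<^sup>2 * (\<epsilon> j)\<^sup>2) > ?S + s}
      \<le> prob {\<epsilon> \<in> space (noise J). \<bar>\<Sum>j=1..n. 0 * \<epsilon> j + (\<sigma> j)\<^sup>2 * ((\<epsilon> j)\<^sup>2 - 1)\<bar> \<ge> s}"
    unfolding eq by (rule finite_measure_mono) auto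
  also have "\<dots> \<le> (\<Sum>j=1..n. 0\<^sup>2 + 2 * ((\<sigma> j)\<^sup>2)\<^sup>2) / s\<^sup>2"
    using noise_quadratic_tail[OF _ K s(1), of "\<lambda>_. 0" "\<lambda>j. (\<sigma> j)\<^sup>2"] by simp
  also have "\<dots> = u"
    using V u by (simp add: s(2) sum_distrib_left[symmetric] power_mult[symmetric] del: zero_less_power2)
  finally show ?thesis unfolding sum_sq_quantile_def s_def[symmetric]
    by (intro quantile_distr_le u) auto
qed

lemma max_sq_quantile_le:
  assumes K: "{1..n} \<subseteq> J" and u: "0 < u" "u < 1" and n: "n \<ge> 2"
  shows "max_sq_quantile J n (1 - u) \<le> 4 * (1 + ln (sqrt 2 / u) / ln 2) * ln (real n)"
proof -
  interpret prob_space "noise J" by (rule prob_space_noise)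
  note [measurable] = comp_measurable_noise[OF K]
  define L where "L = ln (sqrt 2 / u)"
  \<comment> \<open>the point where the tail bound \<open>n * sqrt 2 * exp (- x / 4)\<close> equals \<open>u\<close>\<close>
  define x where "x = 4 * (ln (real n) + L)"
  have [measurable]: "random_variable borel (\<lambda>\<epsilon>. MAX j\<in>{1..n}. (\<epsilon> j)\<^sup>2)"
    by (rule borel_measurable_Max) auto
  have "sqrt 2 > 1" by simp
  then have "sqrt 2 / u \<ge> 1" using u by (simp add: field_simps del: real_sqrt_gt_1_iff)
  then have L0: "L \<ge> 0" unfolding L_def by simp
  \<comment> \<open>as \<open>n \<ge> 2\<close>, the constant \<open>L\<close> is absorbed into a multiple of \<open>ln n\<close>\<close>
  have "ln 2 \<le> ln (real n)" using n by simp
  then have "L * ln 2 \<le> L * ln (real n)" using L0 by (rule mult_left_mono)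
  then have L: "L \<le> L / ln 2 * ln (real n)" by (simp add: field_simps)
  have "exp (ln (real n) + L) = real n * (sqrt 2 / u)"
    using n u by (simp add: exp_add L_def)
  moreover have "- x / 4 = - (ln (real n) + L)" by (simp add: x_def)
  ultimately have "exp (- x / 4) = 1 / (real n * (sqrt 2 / u))"
    by (simp only: exp_minus inverse_eq_divide)
  then have "real n * (sqrt 2 * exp (- x / 4)) = u" using n by simp
  then have "prob {\<epsilon> \<in> space (noise J). (MAX j\<in>{1..n}. (\<epsilon> j)\<^sup>2) > x} \<le> u"
    using noise_max_tail[OF _ _ K, of x] n by simp
  then have "max_sq_quantile J n (1 - u) \<le> x" unfolding max_sq_quantile_def
    by (intro quantile_distr_le u) auto
  also have "x \<le> 4 * (ln (real n) + L / ln 2 * ln (real n))"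
    using L by (simp add: x_def)
  also have "\<dots> = 4 * (1 + L / ln 2) * ln (real n)" by (simp only: algebra_simps)
  finally show ?thesis by (simp add: L_def)
qed

section \<open>Power\<close>

text \<open>If the max test misses, then \<open>\<bar>\<theta> j / \<sigma> j + \<epsilon> j\<bar> \<le> sqrt x\<close>, which forces \<open>\<bar>\<epsilon> j\<bar> \<ge> s\<close>.\<close>

lemma max_test_power:
  assumes K: "{1..n} \<subseteq> J" and j: "j \<in> {1..n}" "\<sigma> j > 0" and q: "q \<le> x" "0 \<le> x" and s: "s > 0"
    and large: "\<bar>\<theta> j\<bar> / \<sigma> j \<ge> sqrt x + s"
  shows "measure (noise J) {\<epsilon> \<in> space (noise J).
    (MAX j\<in>{1..n}. (\<theta> j + \<sigma> j * \<epsilon> j)\<^sup>2 / (\<sigma> j)\<^sup>2) > q} \<ge> 1 - 1 / s\<^sup>2"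
proof -
  interpret prob_space "noise J" by (rule prob_space_noise)
  note [measurable] = comp_measurable_noise[OF K]
  let ?M = "\<lambda>\<epsilon>. MAX j\<in>{1..n}. (\<theta> j + \<sigma> j * \<epsilon> j)\<^sup>2 / (\<sigma> j)\<^sup>2"
  have [measurable]: "random_variable borel ?M"
    by (rule borel_measurable_Max) auto
  have j': "{j} \<subseteq> J" using K j by auto
  note [measurable] = comp_measurable_noise[OF j', of j, simplified]
  have miss: "\<bar>\<epsilon> j\<bar> \<ge> s" if "\<not> ?M \<epsilon> > q" for \<epsilon>
  proof -
    have "(\<theta> j + \<sigma> j * \<epsilon> j)\<^sup>2 / (\<sigma> j)\<^sup>2 \<le> ?M \<epsilon>"
      using j(1) by (intro Max_ge) auto
    then have "(\<theta> j / \<sigma> j + \<epsilon> j)\<^sup>2 \<le> x"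
      using that q(1) j(2) by (simp add: power_divide[symmetric] add_divide_distrib)
    then have "\<bar>\<theta> j / \<sigma> j + \<epsilon> j\<bar> \<le> sqrt x" by (rule real_le_rsqrt[of "\<bar>_\<bar>", simplified])
    moreover have "\<bar>\<theta> j / \<sigma> j\<bar> \<ge> sqrt x + s" using large j(2) by (simp add: abs_divide)
    ultimately show ?thesis by linarith
  qed
  have "prob {\<epsilon> \<in> space (noise J). \<not> ?M \<epsilon> > q}
      \<le> prob {\<epsilon> \<in> space (noise J). \<bar>\<Sum>j\<in>{j}. 1 * \<epsilon> j + 0 * ((\<epsilon> j)\<^sup>2 - 1)\<bar> \<ge> s}"
    using miss by (intro finite_measure_mono) auto
  also have "\<dots> \<le> 1 / s\<^sup>2"
    using noise_quadratic_tail[OF _ j' s, of "\<lambda>_. 1" "\<lambda>_. 0"] by simp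
  finally show ?thesis by (subst (asm) prob_neg) auto
qed

text \<open>The lower bounds on \<open>c\<close> make the critical value exceed \<open>\<Sum> \<sigma>\<^sup>2\<close> by at most half of the signal energy
  \<open>T\<close>, so a miss requires a deviation of at least \<open>T / 2\<close>; they also absorb the noise part \<open>2 V\<close> of
  the variance into \<open>T sqrt V\<close>.\<close>

lemma sum_test_power:
  assumes K: "{1..n} \<subseteq> J" and j: "j \<in> {1..n}"
    and u: "0 < u" "u < 1" and V: "(\<Sum>j=1..n. (\<sigma> j) ^ 4) > 0"
    and c: "c \<ge> 2" "c \<ge> 2 * sqrt (2 / u)"
    and large: "(\<theta> j)\<^sup>2 \<ge> c * sqrt (\<Sum>j=1..n. (\<sigma> j) ^ 4)"
  shows "measure (noise J) {\<epsilon> \<in> space (noise J).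
    (\<Sum>j=1..n. (\<theta> j + \<sigma> j * \<epsilon> j)\<^sup>2) > sum_sq_quantile J \<sigma> n (1 - u)} \<ge> 1 - 20 / c"
proof -
  interpret prob_space "noise J" by (rule prob_space_noise)
  note [measurable] = comp_measurable_noise[OF K]
  let ?V = "\<Sum>j=1..n. (\<sigma> j) ^ 4" and ?S = "\<Sum>j=1..n. (\<sigma> j)\<^sup>2"
  let ?Y = "\<lambda>\<epsilon>. \<Sum>j=1..n. (\<theta> j + \<sigma> j * \<epsilon> j)\<^sup>2"
  let ?Z = "\<lambda>\<epsilon>. \<Sum>j=1..n. (2 * \<theta> j * \<sigma> j) * \<epsilon> j + (\<sigma> j)\<^sup>2 * ((\<epsilon> j)\<^sup>2 - 1)"
  let ?t = "sum_sq_quantile J \<sigma> n (1 - u)"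
  define T where "T = (\<Sum>j=1..n. (\<theta> j)\<^sup>2)"
  define w where "w = sqrt ?V"
  have w: "w > 0" "w\<^sup>2 = ?V" using V by (auto simp: w_def)
  have "(\<theta> j)\<^sup>2 \<le> T" unfolding T_def using j by (intro member_le_sum) auto
  then have T: "c * w \<le> T" using large by (simp add: w_def)
  have T0: "T > 0" using T w(1) c(1) by (smt (verit) mult_pos_pos)
  have decomp: "?Y \<epsilon> = T + ?S + ?Z \<epsilon>" for \<epsilon>
    unfolding T_def sum.distrib[symmetric]
    by (intro sum.cong refl) (simp add: power2_eq_square algebra_simps)
  have t: "?t \<le> ?S + sqrt (2 / u) * w"
    unfolding w_def by (rule sum_sq_quantile_le[OF K u V])
  have "2 * (sqrt (2 / u) * w) \<le> T"
    using T mult_right_mono[OF c(2), of w] w(1) by (simp only: mult.assoc) linarith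
  then have miss: "\<bar>?Z \<epsilon>\<bar> \<ge> T / 2" if "\<not> ?Y \<epsilon> > ?t" for \<epsilon>
    using that t unfolding decomp by linarith
  have \<sigma>w: "(\<sigma> i)\<^sup>2 \<le> w" if "i \<in> {1..n}" for i
  proof -
    have "((\<sigma> i)\<^sup>2)\<^sup>2 \<le> ?V"
      using that member_le_sum[of i "{1..n}" "\<lambda>i. (\<sigma> i) ^ 4"] by (simp add: power_mult[symmetric])
    then show ?thesis unfolding w_def by (rule real_le_rsqrt)
  qed
  have "(\<Sum>j=1..n. (2 * \<theta> j * \<sigma> j)\<^sup>2 + 2 * ((\<sigma> j)\<^sup>2)\<^sup>2)
      = 4 * (\<Sum>j=1..n. (\<theta> j)\<^sup>2 * (\<sigma> j)\<^sup>2) + 2 * ?V"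
    by (simp add: sum.distrib sum_distrib_left power_mult_distrib power_mult[symmetric] mult.assoc)
  also have "\<dots> \<le> 4 * (T * w) + 2 * w\<^sup>2"
  proof -
    have "(\<Sum>j=1..n. (\<theta> j)\<^sup>2 * (\<sigma> j)\<^sup>2) \<le> T * w"
      unfolding T_def sum_distrib_right using \<sigma>w by (intro sum_mono mult_left_mono) auto
    then show ?thesis by (simp add: w(2))
  qed
  also have "\<dots> \<le> 5 * (T * w)"
  proof -
    have "2 * w \<le> T" using T mult_right_mono[OF c(1), of w] w(1) by linarith
    then have "2 * w * w \<le> T * w" using w(1) by (intro mult_right_mono) auto
    then show ?thesis by (simp add: power2_eq_square)
  qed
  finally have var: "(\<Sum>j=1..n. (2 * \<theta> j * \<sigma> j)\<^sup>2 + 2 * ((\<sigma> j)\<^sup>2)\<^sup>2) \<le> 5 * (T * w)" .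
  have "prob {\<epsilon> \<in> space (noise J). \<not> ?Y \<epsilon> > ?t} \<le> prob {\<epsilon> \<in> space (noise J). \<bar>?Z \<epsilon>\<bar> \<ge> T / 2}"
    using miss by (intro finite_measure_mono) auto
  also have "\<dots> \<le> (\<Sum>j=1..n. (2 * \<theta> j * \<sigma> j)\<^sup>2 + 2 * ((\<sigma> j)\<^sup>2)\<^sup>2) / (T / 2)\<^sup>2"
    using T0 by (intro noise_quadratic_tail K) auto
  also have "\<dots> \<le> 5 * (T * w) / (T / 2)\<^sup>2"
    using var by (intro divide_right_mono) auto
  also have "\<dots> = 20 * w / T" using T0 by (simp add: power2_eq_square field_simps)
  also have "\<dots> \<le> 20 / c" using T T0 w(1) c(1) by (simp add: field_simps)
  finally show ?thesis by (subst (asm) prob_neg) auto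
qed

lemma le_order_stat_last:
  assumes "j \<in> {1..n}"
  shows "\<sigma> j \<le> order_stat \<sigma> n n"
proof -
  let ?xs = "sort (map \<sigma> [1..<Suc n])"
  have "j \<in> set [1..<Suc n]" using assms by (simp only: set_upt) auto
  then have "\<sigma> j \<in> set ?xs" by (simp only: set_sort set_map) (rule imageI)
  then obtain i where "i < length ?xs" "?xs ! i = \<sigma> j" by (auto simp only: in_set_conv_nth)
  moreover have "?xs ! i \<le> ?xs ! (n - 1)" if "i < length ?xs" for i
    using that assms by (intro sorted_nth_mono) auto
  ultimately show ?thesis by (metis order_stat_def)
qed

lemma linf_norm_attained:
  assumes K: "{1..n} \<subseteq> J" "n \<ge> 1" and zero: "\<And>j. j \<in> J \<Longrightarrow> j > n \<Longrightarrow> \<theta> j = 0"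
    and J: "\<And>j. j \<in> J \<Longrightarrow> j \<ge> 1"
  obtains j where "j \<in> {1..n}" "linf_norm J \<theta> \<le> \<bar>\<theta> j\<bar>"
proof -
  let ?M = "MAX j\<in>{1..n}. \<bar>\<theta> j\<bar>"
  have "?M \<in> (\<lambda>j. \<bar>\<theta> j\<bar>) ` {1..n}" using K(2) by (intro Max_in) auto
  then obtain j where j: "j \<in> {1..n}" "?M = \<bar>\<theta> j\<bar>" by auto
  have "linf_norm J \<theta> \<le> ?M" unfolding linf_norm_def
  proof (rule cSUP_least)
    show "J \<noteq> {}" using K by auto
    fix i assume i: "i \<in> J"
    show "\<bar>\<theta> i\<bar> \<le> ?M"
    proof (cases "i \<le> n")
      case True
      then show ?thesis using J[OF i] by (intro Max_ge) auto
    next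
      case False
      then show ?thesis using zero[OF i] j(2) by simp
    qed
  qed
  then show ?thesis using that j by simp
qed

text \<open>The combined test rejects whenever one of its parts does, so only the part whose threshold
  attains the minimum has to be considered.\<close>

lemma combined_test_power:
  assumes "0 < \<alpha>" "\<alpha> < 1" "0 < \<gamma>"
  obtains C :: real where "C > 0"
    "\<And>J \<sigma> n \<theta> j. {1..n} \<subseteq> J \<Longrightarrow> \<forall>j\<in>J. \<sigma> j > 0 \<Longrightarrow> n \<ge> 2 \<Longrightarrow> j \<in> {1..n} \<Longrightarrow>
      C * min (order_stat \<sigma> n n * sqrt (ln (real n))) ((\<Sum>j=1..n. (\<sigma> j) ^ 4) powr (1 / 4)) \<le> \<bar>\<theta> j\<bar> \<Longrightarrow>
      1 - \<gamma> \<le> reject_prob J \<sigma> \<theta> (combined_test J \<sigma> n \<alpha>)"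
proof -
  define u where "u = \<alpha> / 2"
  have u: "0 < u" "u < 1" using assms by (auto simp: u_def)
  \<comment> \<open>\<open>A ln n\<close> bounds the critical value of the max test; \<open>B sqrt (ln n)\<close> with \<open>n \<ge> 2\<close> is exceeded by
    a single noise coordinate with probability at most \<open>\<gamma>\<close>; the other summands of \<open>C\<close> serve
    the sum test\<close>
  define A where "A = 4 * (1 + ln (sqrt 2 / u) / ln 2)"
  define B where "B = 1 / sqrt (\<gamma> * ln 2)"
  define C where "C = 2 + sqrt A + B + 2 * sqrt (2 / u) + 20 / \<gamma>"
  have "sqrt 2 > 1" by simp
  then have "sqrt 2 / u \<ge> 1" using u by (simp add: field_simps del: real_sqrt_gt_1_iff)
  then have A: "A \<ge> 0" by (auto simp: A_def)
  have B: "B > 0" "B\<^sup>2 * ln 2 = 1 / \<gamma>" using assms(3) by (auto simp: B_def power_divide)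
  have summands: "sqrt A \<ge> 0" "2 * sqrt (2 / u) \<ge> 0" "20 / \<gamma> > 0"
    using A u assms(3) by auto
  have C: "C \<ge> 2" "C \<ge> sqrt A + B" "C \<ge> 2 * sqrt (2 / u)" "C \<ge> 20 / \<gamma>"
    unfolding C_def using summands B(1) by linarith+
  have CC: "C \<le> C\<^sup>2" using C(1) by (simp add: power2_eq_square)
  show thesis
  proof (rule that[of C])
    show "C > 0" using C(1) by simp
    fix J :: "nat set" and \<sigma> \<theta> :: "nat \<Rightarrow> real" and n j :: nat
    let ?V = "\<Sum>j=1..n. (\<sigma> j) ^ 4"
    assume K: "{1..n} \<subseteq> J" and pos: "\<forall>j\<in>J. \<sigma> j > 0" and n: "n \<ge> 2" and j: "j \<in> {1..n}"
      and large: "C * min (order_stat \<sigma> n n * sqrt (ln (real n))) (?V powr (1 / 4)) \<le> \<bar>\<theta> j\<bar>"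
    interpret prob_space "noise J" by (rule prob_space_noise)
    note [measurable] = comp_measurable_noise[OF K]
    let ?t = "sum_sq_quantile J \<sigma> n (1 - u)" and ?q = "max_sq_quantile J n (1 - u)"
    let ?Y = "\<lambda>\<epsilon>. \<Sum>j=1..n. (\<theta> j + \<sigma> j * \<epsilon> j)\<^sup>2"
    let ?M = "\<lambda>\<epsilon>. MAX j\<in>{1..n}. (\<theta> j + \<sigma> j * \<epsilon> j)\<^sup>2 / (\<sigma> j)\<^sup>2"
    have [measurable]: "random_variable borel ?M"
      by (rule borel_measurable_Max) auto
    have \<sigma>j: "\<sigma> j > 0" using pos j K by auto
    have rp: "reject_prob J \<sigma> \<theta> (combined_test J \<sigma> n \<alpha>)
        = prob {\<epsilon> \<in> space (noise J). ?Y \<epsilon> > ?t \<or> ?M \<epsilon> > ?q}"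
      using reject_prob_combined_test[OF K, of \<sigma> \<theta> \<alpha>] n by (simp add: u_def)
    show "1 - \<gamma> \<le> reject_prob J \<sigma> \<theta> (combined_test J \<sigma> n \<alpha>)"
    proof (cases "order_stat \<sigma> n n * sqrt (ln (real n)) \<le> ?V powr (1 / 4)")
      case True
      define l where "l = ln (real n)"
      have l: "ln 2 \<le> l" "0 < l" using n by (auto simp: l_def)
      have "C * (order_stat \<sigma> n n * sqrt l) \<le> \<bar>\<theta> j\<bar>" using large True by (simp add: l_def)
      moreover have "C * (\<sigma> j * sqrt l) \<le> C * (order_stat \<sigma> n n * sqrt l)"
        using le_order_stat_last[OF j, of \<sigma>] l C(1) by (intro mult_left_mono mult_right_mono) auto
      ultimately have "C * sqrt l \<le> \<bar>\<theta> j\<bar> / \<sigma> j" using \<sigma>j by (simp add: field_simps)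
      moreover have "(sqrt A + B) * sqrt l \<le> C * sqrt l"
        using C(2) l by (intro mult_right_mono) auto
      ultimately have "sqrt (A * l) + B * sqrt l \<le> \<bar>\<theta> j\<bar> / \<sigma> j"
        by (simp add: real_sqrt_mult algebra_simps)
      moreover have "?q \<le> A * l"
        unfolding A_def l_def by (rule max_sq_quantile_le[OF K u n])
      ultimately have "1 - 1 / (B * sqrt l)\<^sup>2 \<le> prob {\<epsilon> \<in> space (noise J). ?M \<epsilon> > ?q}"
        using A B(1) l by (intro max_test_power[where \<sigma> = \<sigma> and \<theta> = \<theta> and x = "A * l", OF K j \<sigma>j]) auto
      also have "\<dots> \<le> prob {\<epsilon> \<in> space (noise J). ?Y \<epsilon> > ?t \<or> ?M \<epsilon> > ?q}"
        by (rule finite_measure_mono) auto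
      finally have "1 - 1 / (B * sqrt l)\<^sup>2 \<le> \<dots>" .
      moreover have "1 / (B * sqrt l)\<^sup>2 \<le> \<gamma>"
      proof -
        have "1 / \<gamma> \<le> B\<^sup>2 * l" unfolding B(2)[symmetric] using l by (intro mult_left_mono) auto
        then have "1 \<le> \<gamma> * (B\<^sup>2 * l)" using assms(3) by (simp add: field_simps)
        then show ?thesis using l B(1) by (simp add: power_mult_distrib field_simps)
      qed
      ultimately show ?thesis unfolding rp by linarith
    next
      case False
      have V: "?V > 0"
      proof (rule sum_pos)
        show "0 < \<sigma> i ^ 4" if "i \<in> {1..n}" for i
          using pos that K by (intro zero_less_power) auto
      qed (use n in auto)
      have "C * ?V powr (1 / 4) \<le> \<bar>\<theta> j\<bar>" using large False by simp
      then have "(C * ?V powr (1 / 4))\<^sup>2 \<le> (\<theta> j)\<^sup>2"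
        using C(1) by (intro abs_le_square_iff[THEN iffD1]) auto
      moreover have "(?V powr (1 / 4))\<^sup>2 = sqrt ?V"
        using V by (simp add: powr_half_sqrt[symmetric] power2_eq_square powr_add[symmetric])
      ultimately have "C\<^sup>2 * sqrt ?V \<le> (\<theta> j)\<^sup>2" by (simp add: power_mult_distrib)
      moreover have "C * sqrt ?V \<le> C\<^sup>2 * sqrt ?V" using CC V by (intro mult_right_mono) auto
      ultimately have "C * sqrt ?V \<le> (\<theta> j)\<^sup>2" by linarith
      then have "1 - 20 / C \<le> prob {\<epsilon> \<in> space (noise J). ?Y \<epsilon> > ?t}"
        by (intro sum_test_power[OF K j u V C(1,3)])
      also have "\<dots> \<le> prob {\<epsilon> \<in> space (noise J). ?Y \<epsilon> > ?t \<or> ?M \<epsilon> > ?q}"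
        by (rule finite_measure_mono) auto
      finally have "1 - 20 / C \<le> \<dots>" .
      moreover have "20 / C \<le> \<gamma>" using C(1,4) assms(3) by (simp add: field_simps)
      ultimately show ?thesis unfolding rp by linarith
    qed
  qed
qed

section \<open>The separation rate\<close>

text \<open>The gap between \<open>\<gamma>\<close> and \<open>\<beta>\<close> turns the pointwise bound into the strict inequality for the infimum
  over \<open>F\<close> that the definition of the rate requires.\<close>

lemma minimax_rate_inf_le:
  assumes "level_test J \<sigma> \<alpha> \<Phi>" "\<rho> > 0" "\<gamma> < \<beta>"
    and "\<And>\<theta>. \<theta> \<in> F \<Longrightarrow> \<rho> \<le> linf_norm J \<theta> \<Longrightarrow> 1 - \<gamma> \<le> reject_prob J \<sigma> \<theta> \<Phi>"
  shows "minimax_rate_inf J \<sigma> F \<alpha> \<beta> \<le> ereal \<rho>"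
proof -
  have "minimax_rate_inf J \<sigma> F \<alpha> \<beta> \<le> test_rate_inf J \<sigma> \<Phi> F \<beta>"
    unfolding minimax_rate_inf_def using assms(1) by (intro INF_lower) auto
  also have "\<dots> \<le> ereal \<rho>"
    unfolding test_rate_inf_def
  proof (rule Inf_lower, rule imageI, safe)
    show "\<rho> > 0" by fact
    have "ereal (1 - \<beta>) < ereal (1 - \<gamma>)" using assms(3) by simp
    also have "\<dots> \<le> (INF \<theta>\<in>{\<theta>\<in>F. linf_norm J \<theta> \<ge> \<rho>}. ereal (reject_prob J \<sigma> \<theta> \<Phi>))"
      using assms(4) by (intro INF_greatest) auto
    finally show "ereal (1 - \<beta>) < \<dots>" .
  qed
  finally show ?thesis .
qed

theorem corollary2:
  fixes \<alpha> \<beta> :: real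
  assumes "0 < \<alpha>" "\<alpha> < 1" "0 < \<beta>" "\<beta> < 1"
  shows "\<exists>C::real. C > 0 \<and>
    (\<forall>(J :: nat set) (\<sigma> :: nat \<Rightarrow> real) (n :: nat).
      index_set J \<longrightarrow> (\<forall>j\<in>J. \<sigma> j > 0) \<longrightarrow> n \<in> J \<longrightarrow> n \<ge> 2 \<longrightarrow>
      (let r = min (order_stat \<sigma> n n * sqrt (ln (real n)))
                   ((\<Sum>j=1..n. (\<sigma> j) ^ 4) powr (1 / 4))
       in (\<forall>k\<in>{1..n}. \<forall>\<theta>\<in>sparse_set J k n. linf_norm J \<theta> \<ge> C * r \<longrightarrow>
             reject_prob J \<sigma> \<theta> (combined_test J \<sigma> n \<alpha>) > 1 - \<beta>) \<and>
          (\<forall>k\<in>{1..n}. minimax_rate_inf J \<sigma> (sparse_set J k n) \<alpha> \<beta> \<le> ereal (C * r))))"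
proof -
  have \<gamma>: "0 < \<beta> / 2" "\<beta> / 2 < \<beta>" using assms by auto
  obtain C :: real where "C > 0" and power:
    "\<And>J \<sigma> n \<theta> j. {1..n} \<subseteq> J \<Longrightarrow> \<forall>j\<in>J. \<sigma> j > 0 \<Longrightarrow> n \<ge> 2 \<Longrightarrow> j \<in> {1..n} \<Longrightarrow>
      C * min (order_stat \<sigma> n n * sqrt (ln (real n))) ((\<Sum>j=1..n. (\<sigma> j) ^ 4) powr (1 / 4)) \<le> \<bar>\<theta> j\<bar> \<Longrightarrow>
      1 - \<beta> / 2 \<le> reject_prob J \<sigma> \<theta> (combined_test J \<sigma> n \<alpha>)"
    using combined_test_power[OF assms(1,2) \<gamma>(1)] by blast
  show ?thesis
    unfolding Let_def
  proof (intro exI[of _ C] conjI allI impI ballI)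
    show "C > 0" by fact
    fix J :: "nat set" and \<sigma> :: "nat \<Rightarrow> real" and n k :: nat
    let ?r = "min (order_stat \<sigma> n n * sqrt (ln (real n))) ((\<Sum>j=1..n. (\<sigma> j) ^ 4) powr (1 / 4))"
    assume J: "index_set J" and pos: "\<forall>j\<in>J. \<sigma> j > 0" and n: "n \<in> J" "n \<ge> 2"
    have K: "{1..n} \<subseteq> J" and J1: "\<And>j. j \<in> J \<Longrightarrow> j \<ge> 1"
      using J n(1) by (auto simp: index_set_def)
    have rej: "1 - \<beta> / 2 \<le> reject_prob J \<sigma> \<theta> (combined_test J \<sigma> n \<alpha>)"
      if \<theta>: "\<theta> \<in> sparse_set J k n" and large: "C * ?r \<le> linf_norm J \<theta>" for \<theta> k
    proof -
      obtain j where "j \<in> {1..n}" "linf_norm J \<theta> \<le> \<bar>\<theta> j\<bar>"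
        using linf_norm_attained[OF K, of \<theta>] \<theta> J1 n(2) by (auto simp: sparse_set_def)
      then show ?thesis using large by (intro power[OF K pos n(2)]) auto
    qed
    show "reject_prob J \<sigma> \<theta> (combined_test J \<sigma> n \<alpha>) > 1 - \<beta>"
      if "\<theta> \<in> sparse_set J k n" "C * ?r \<le> linf_norm J \<theta>" for \<theta>
      using rej[OF that] \<gamma> by linarith
    show "minimax_rate_inf J \<sigma> (sparse_set J k n) \<alpha> \<beta> \<le> ereal (C * ?r)"
    proof (rule minimax_rate_inf_le[OF _ _ \<gamma>(2)])
      show "level_test J \<sigma> \<alpha> (combined_test J \<sigma> n \<alpha>)"
        using n(2) by (intro level_combined_test K pos assms) auto
      have \<sigma>pos: "\<sigma> i > 0" if "i \<in> {1..n}" for i using pos that K by auto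
      have "(\<Sum>j=1..n. (\<sigma> j) ^ 4) > 0"
        using \<sigma>pos n(2) by (intro sum_pos zero_less_power) auto
      moreover have "order_stat \<sigma> n n > 0"
        using le_order_stat_last[of n n \<sigma>] \<sigma>pos[of n] n(2) by simp
      ultimately show "C * ?r > 0" using \<open>C > 0\<close> n(2) by simp
      show "1 - \<beta> / 2 \<le> reject_prob J \<sigma> \<theta> (combined_test J \<sigma> n \<alpha>)"
        if "\<theta> \<in> sparse_set J k n" "C * ?r \<le> linf_norm J \<theta>" for \<theta>
        using that by (rule rej)
    qed
  qed
qed

end
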